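(* Let $X_i\in\{e_1,\dots,e_d\}$ for $i\in[n]$, where $e_1,\dots,e_d\in\{0,1\}^d$ are the one-hot (standard basis) vectors, in the regime $d\gg n$. Consider aggregation protocols (as defined in the context) satisfying the correctness constraint (C1) and the security constraints (S1) and (S2) with dropout tolerance $D\le n/2$, in the case where no user drops out. There exists a worst-case prior distribution $\pi_{X^n}$ of $X^n=(X_1,\dots,X_n)$ such that, for all $i\in[n]$, $$H(Y_i)\ \ge\ H\Big(\sum_{j=1}^nX_j\Big)\ =\ \Omega(n\log d),$$ where the entropy $H\big(\sum_{j=1}^n X_j\big)$ is computed with respect to $X^n\sim\pi_{X^n}$.
   Context: $[n]=\{1,\dots,n\}$; $H(\cdot)$ is Shannon entropy (base 2); $I(\cdot;\cdot)$ and $I(\cdot;\cdot\mid\cdot)$ are (conditional) mutual information; $X_A=(X_i)_{i\in A}$ and $\mu(X_A)=\sum_{i\in A}X_i$ for $A\subseteq[n]$. Aggregation protocol. There are a single server and $n$ users; user $i\in[n]$ holds $X_i$, and the server wants the sum of the users' vectors (the histogram of the items). User $i$ encodes $X_i$ as $Y_i=g_i(X_i;\theta_i)$, where $g_i$ is an encoding function and $\theta_i$ is randomness available at user $i$, independent of $X_i$ but possibly dependent on the other $\theta_{i'}$, $i'\in[n]\setminus\{i\}$. Up to $D$ users may drop out. If the set of dropouts is $\mathcal{D}$, the server observes $Y_{[n]\setminus\mathcal{D}}$. If $\mathcal{D}=\emptyset$, it estimates the sum by a deterministic function $f(Y^n)$. If $\mathcal{D}\ne\emptyset$, the server in a second round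 of communication collects $h(\theta_{[n]},\mathcal{D})$, where $h$ is a general function of the local secrets $\theta_{[n]}$, and estimates $\mu(X_{[n]\setminus\mathcal{D}})$ by $f(Y_{[n]\setminus\mathcal{D}},h(\theta_{[n]},\mathcal{D}))$. Security constraints with dropout tolerance $D$ (a number, not to be confused with the set $\mathcal D$), required for every distribution $P_{X^n}$ of the user data: (S1) for all $\mathcal{D}\subseteq[n]$: $I\big(Y_{[n]\setminus\mathcal{D}},h(\theta_{[n]},\mathcal{D});X_{[n]\setminus\mathcal{D}}\,\big|\,\mu(X_{[n]\setminus\mathcal{D}})\big)=0$; (S2) for all $\mathcal{D}$ with $|\mathcal{D}|>D$: $I\big(Y_{[n]\setminus\mathcal{D}},h(\theta_{[n]},\mathcal{D});X_{[n]\setminus\mathcal{D}}\big)=0$. Correctness constraint: (C1) for all $\mathcal{D}$ with $|\mathcal{D}|\le D$: $\Pr\{f(Y_{[n]\setminus\mathcal{D}},h(\theta_{[n]},\mathcal{D}))=\mu(X_{[n]\setminus\mathcal{D}})\}=1$.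
   Formalization: The regime d ≫ n is taken as d ≥ n^{1+ε} for an arbitrary fixed ε > 0, with the Ω constant depending on ε; under d/n → ∞ alone the bound fails, e.g. for d = n log n, where H(sum) = O(n log log n). *)

theory Defs
  imports "HOL-Probability.Probability" "HOL-Library.Landau_Symbols"
begin

section \<open>Data vectors\<close>

text \<open>Vectors of length \<open>d\<close> are functions on \<open>nat\<close> that vanish outside \<open>{1..d}\<close>, so that \<open>d\<close> can vary
  inside a statement. The one-hot vectors are \<open>e 1, \<dots>, e d\<close>.\<close>

type_synonym vec = "nat \<Rightarrow> nat"

definition one_hot :: "nat \<Rightarrow> vec"
  where "one_hot k = (\<lambda>l. if l = k then 1 else 0)"

definition one_hots :: "nat \<Rightarrow> vec set"
  where "one_hots d = one_hot ` {1..d}"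

definition vsum :: "nat set \<Rightarrow> (nat \<Rightarrow> vec) \<Rightarrow> vec"
  where "vsum A x = (\<lambda>l. \<Sum>i\<in>A. x i l)"

text \<open>The possible values of \<open>X\<^sub>A\<close>; \<open>PiE\<close> makes the functions \<open>undefined\<close> outside \<open>A\<close>.\<close>

definition data :: "nat \<Rightarrow> nat set \<Rightarrow> (nat \<Rightarrow> vec) set"
  where "data d A = A \<rightarrow>\<^sub>E one_hots d"

definition data_prior :: "nat \<Rightarrow> nat \<Rightarrow> (nat \<Rightarrow> vec) measure \<Rightarrow> bool"
  where "data_prior n d P \<longleftrightarrow> prob_space P \<and> sets P = sets (count_space (data d {1..n}))"

section \<open>Shannon entropy of a discrete random variable\<close>

text \<open>The library's \<open>entropy\<close> is a Bochner integral and hence \<open>0\<close> when the entropy is infinite. Messages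
  range over countable alphabets, so infinite entropy must be allowed. For a variable with finite range
  both notions agree.\<close>

definition shannon_entropy :: "'a measure \<Rightarrow> ('a \<Rightarrow> 'b) \<Rightarrow> ennreal"
  where "shannon_entropy M X =
    (\<integral>\<^sup>+ y. (let p = measure M (X -` {y} \<inter> space M) in ennreal (- p * log 2 p)) \<partial>count_space UNIV)"

lemma shannon_entropy_eq_entropy:
  assumes "prob_space M" and X: "simple_function M X"
  shows "shannon_entropy M X = ennreal (prob_space.entropy M 2 (count_space (X ` space M)) X)"
proof -
  interpret information_space M 2
    using assms(1) by (simp add: information_space_def information_space_axioms_def)
  define p where "p y = prob (X -` {y} \<inter> space M)" for y
  have fin: "finite (X ` space M)"
    using X by (rule simple_functionD)
  have nonneg: "0 \<le> - p y * log 2 (p y)" for y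
    by (cases "p y = 0") (auto simp: p_def zero_less_measure_iff mult_le_0_iff)
  have zero: "p y = 0" if "y \<notin> X ` space M" for y
  proof -
    have "X -` {y} \<inter> space M = {}" using that by auto
    then show ?thesis by (simp only: p_def measure_empty)
  qed
  have "shannon_entropy M X = (\<integral>\<^sup>+ y. ennreal (- p y * log 2 (p y)) \<partial>count_space UNIV)"
    by (simp add: shannon_entropy_def p_def Let_def)
  also have "\<dots> = (\<Sum>y\<in>X ` space M. ennreal (- p y * log 2 (p y)))"
    by (rule nn_integral_count_space'[OF fin]) (auto simp: zero)
  also have "\<dots> = ennreal (\<Sum>y\<in>X ` space M. - p y * log 2 (p y))"
    by (rule sum_ennreal) (rule nonneg)
  also have "(\<Sum>y\<in>X ` space M. - p y * log 2 (p y)) = entropy 2 (count_space (X ` space M)) X"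
    by (simp add: entropy_simple_distributed[OF simple_distributedI[OF X measure_nonneg refl]]
        p_def sum_negf)
  finally show ?thesis .
qed

section \<open>Aggregation protocols\<close>

text \<open>\<open>rand_law\<close> is the joint law of \<open>(\<theta>\<^sub>1, \<dots>, \<theta>\<^sub>n)\<close>, with arbitrary dependence between the
  \<open>\<theta>\<^sub>i\<close>. The decoder receives the dropout set explicitly, as it does through the index set of the
  messages it observes.\<close>

record ('t, 'y, 'h) protocol =
  rand_space :: "nat \<Rightarrow> 't measure"
  rand_law :: "(nat \<Rightarrow> 't) measure"
  enc :: "nat \<Rightarrow> vec \<Rightarrow> 't \<Rightarrow> 'y"
  round2_space :: "'h measure"
  round2 :: "(nat \<Rightarrow> 't) \<Rightarrow> nat set \<Rightarrow> 'h"
  dec :: "nat set \<Rightarrow> (nat \<Rightarrow> 'y) \<Rightarrow> 'h \<Rightarrow> vec"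

text \<open>The last condition says that there is no second round without dropouts: \<open>h(\<theta>, {})\<close> is a
  constant and carries no information.\<close>

definition aggregation_protocol :: "nat \<Rightarrow> nat \<Rightarrow> ('t, 'y::countable, 'h) protocol \<Rightarrow> bool"
  where "aggregation_protocol n d pr \<longleftrightarrow>
    prob_space (rand_law pr) \<and>
    sets (rand_law pr) = sets (PiM {1..n} (rand_space pr)) \<and>
    (\<forall>i\<in>{1..n}. \<forall>v\<in>one_hots d. enc pr i v \<in> rand_space pr i \<rightarrow>\<^sub>M count_space UNIV) \<and>
    (\<forall>Dr\<subseteq>{1..n}. (\<lambda>t. round2 pr t Dr) \<in> rand_law pr \<rightarrow>\<^sub>M round2_space pr) \<and>
    (\<exists>c. \<forall>t\<in>space (rand_law pr). round2 pr t {} = c)"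

text \<open>An outcome is a pair of the data and the randomness, which are independent.\<close>

definition joint :: "(nat \<Rightarrow> vec) measure \<Rightarrow> ('t, 'y, 'h) protocol \<Rightarrow> ((nat \<Rightarrow> vec) \<times> (nat \<Rightarrow> 't)) measure"
  where "joint P pr = P \<Otimes>\<^sub>M rand_law pr"

definition msg :: "('t, 'y, 'h) protocol \<Rightarrow> nat \<Rightarrow> (nat \<Rightarrow> vec) \<times> (nat \<Rightarrow> 't) \<Rightarrow> 'y"
  where "msg pr i = (\<lambda>(x, t). enc pr i (x i) (t i))"

definition msgs :: "('t, 'y, 'h) protocol \<Rightarrow> nat set \<Rightarrow> (nat \<Rightarrow> vec) \<times> (nat \<Rightarrow> 't) \<Rightarrow> nat \<Rightarrow> 'y"
  where "msgs pr A \<omega> = (\<lambda>i\<in>A. msg pr i \<omega>)"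

definition server_view ::
    "('t, 'y, 'h) protocol \<Rightarrow> nat \<Rightarrow> nat set \<Rightarrow> (nat \<Rightarrow> vec) \<times> (nat \<Rightarrow> 't) \<Rightarrow> (nat \<Rightarrow> 'y) \<times> 'h"
  where "server_view pr n Dr \<omega> = (msgs pr ({1..n} - Dr) \<omega>, round2 pr (snd \<omega>) Dr)"

definition view_space :: "('t, 'y, 'h) protocol \<Rightarrow> nat \<Rightarrow> nat set \<Rightarrow> ((nat \<Rightarrow> 'y) \<times> 'h) measure"
  where "view_space pr n Dr = PiM ({1..n} - Dr) (\<lambda>_. count_space UNIV) \<Otimes>\<^sub>M round2_space pr"

section \<open>Correctness and security\<close>

text \<open>The library's (conditional) mutual information is a real-valued Bochner integral. It is the usual
  quantity below because the data range over a finite set.\<close>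

definition secure_given_sum :: "nat \<Rightarrow> nat \<Rightarrow> ('t, 'y, 'h) protocol \<Rightarrow> bool"
  where "secure_given_sum n d pr \<longleftrightarrow>
    (\<forall>P. data_prior n d P \<longrightarrow> (\<forall>Dr\<subseteq>{1..n}.
      prob_space.conditional_mutual_information (joint P pr) 2
        (view_space pr n Dr) (count_space (data d ({1..n} - Dr))) (count_space UNIV)
        (server_view pr n Dr)
        (\<lambda>\<omega>. restrict (fst \<omega>) ({1..n} - Dr))
        (\<lambda>\<omega>. vsum ({1..n} - Dr) (fst \<omega>)) = 0))"

definition secure_many_dropouts :: "nat \<Rightarrow> nat \<Rightarrow> nat \<Rightarrow> ('t, 'y, 'h) protocol \<Rightarrow> bool"
  where "secure_many_dropouts n d D pr \<longleftrightarrow>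
    (\<forall>P. data_prior n d P \<longrightarrow> (\<forall>Dr\<subseteq>{1..n}. card Dr > D \<longrightarrow>
      prob_space.mutual_information (joint P pr) 2
        (view_space pr n Dr) (count_space (data d ({1..n} - Dr)))
        (server_view pr n Dr)
        (\<lambda>\<omega>. restrict (fst \<omega>) ({1..n} - Dr)) = 0))"

definition correct :: "nat \<Rightarrow> nat \<Rightarrow> nat \<Rightarrow> ('t, 'y, 'h) protocol \<Rightarrow> bool"
  where "correct n d D pr \<longleftrightarrow>
    (\<forall>P. data_prior n d P \<longrightarrow> (\<forall>Dr\<subseteq>{1..n}. card Dr \<le> D \<longrightarrow>
      (AE \<omega> in joint P pr.
        dec pr Dr (msgs pr ({1..n} - Dr) \<omega>) (round2 pr (snd \<omega>) Dr) = vsum ({1..n} - Dr) (fst \<omega>))))"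

section \<open>The regime in which the dimension is much larger than the number of users\<close>

text \<open>The entropy of the sum is at most \<open>log 2 ((n + d - 1) choose n)\<close>, which is \<open>o(n log d)\<close> along, for
  example, \<open>d = n log n\<close>, although \<open>d / n\<close> tends to infinity. A bound \<open>\<Omega>(n log d)\<close> needs polynomial
  separation, with an arbitrary exponent above one.\<close>

definition large_dim :: "real \<Rightarrow> (nat \<times> nat) set"
  where "large_dim \<epsilon> = {(n, d). 1 \<le> n \<and> real n powr (1 + \<epsilon>) \<le> real d}"

end

theory Submission
  imports Defs
begin

text \<open>For data \<open>x\<close> let \<open>L\<^sub>x\<close> be the law of the messages of all users. Applied to a prior with constant
  sum, (S1) without dropouts says that \<open>L\<^sub>x\<close> depends on \<open>x\<close> only through the sum. The marginal of \<open>L\<^sub>x\<close> on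
  the messages of the users other than \<open>i\<close> moreover does not depend on \<open>x\<^sub>i\<close>, and together the two
  invariances make this marginal independent of \<open>x\<close>. By (C1), given the messages of the others, the
  values of \<open>Y\<^sub>i\<close> that occur for different sums are different; hence if the prior makes the sum uniform
  on its \<open>N\<close> possible values, each value of \<open>Y\<^sub>i\<close> has probability at most \<open>1 / N\<close>, and
  \<open>H(Y\<^sub>i) \<ge> log N = H(\<Sum> X\<^sub>j)\<close>. Finally a sum determines the data up to \<open>n\<^sup>n\<close> choices, so \<open>N \<ge> d\<^sup>n / n\<^sup>n\<close>,
  and \<open>log n \<le> log d / (1 + \<epsilon>)\<close> in the given regime. The prior is uniform on one representative
  of every sum.\<close>

section \<open>Vanishing mutual information\<close>

text \<open>On the set \<open>A\<close> where the density exceeds \<open>K\<close>, the integral of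
  the excess is \<open>N A - K * M A\<close>. This is \<open>0\<close> in truncated subtraction by
  the domination hypothesis, so the excess vanishes almost everywhere.\<close>

lemma (in prob_space) AE_RN_deriv_le:
  assumes N: "finite_measure N" "sets N = sets M" and ac: "absolutely_continuous M N"
    and le: "\<And>A. A \<in> sets M \<Longrightarrow> emeasure N A \<le> ennreal K * emeasure M A"
  shows "AE x in M. RN_deriv M N x \<le> ennreal K"
proof -
  define f where "f = RN_deriv M N"
  have [measurable]: "f \<in> borel_measurable M" by (simp add: f_def)
  define A where "A = {x \<in> space M. ennreal K < f x}"
  have [measurable]: "A \<in> sets M" by (simp add: A_def)
  have "N = density M f"
    unfolding f_def using ac N(2) by (rule density_RN_deriv[symmetric])
  then have fA: "(\<integral>\<^sup>+x. f x * indicator A x \<partial>M) = emeasure N A"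
    by (simp add: emeasure_density)
  have KA: "(\<integral>\<^sup>+x. ennreal K * indicator A x \<partial>M) = ennreal K * emeasure M A"
    by (simp add: nn_integral_cmult_indicator)
  have "(\<integral>\<^sup>+x. f x * indicator A x - ennreal K * indicator A x \<partial>M)
      = (\<integral>\<^sup>+x. f x * indicator A x \<partial>M) - (\<integral>\<^sup>+x. ennreal K * indicator A x \<partial>M)"
  proof (rule nn_integral_diff)
    show "(\<integral>\<^sup>+x. ennreal K * indicator A x \<partial>M) \<noteq> \<infinity>"
      unfolding KA by (simp add: emeasure_eq_measure ennreal_mult_eq_top_iff)
  qed (auto simp: A_def indicator_def less_imp_le)
  also have "\<dots> = 0"
    unfolding fA KA using le[of A] finite_measure.emeasure_finite[OF N(1), of A]
    by (simp add: diff_eq_0_iff_ennreal less_top)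
  finally have "AE x in M. f x * indicator A x - ennreal K * indicator A x = 0"
    by (subst (asm) nn_integral_0_iff_AE) auto
  then have "AE x in M. f x \<le> ennreal K"
    using AE_space
  proof eventually_elim
    case (elim x)
    show ?case
    proof (rule ccontr)
      assume "\<not> f x \<le> ennreal K"
      with elim have "f x - ennreal K = 0" "ennreal K < f x" by (auto simp: A_def)
      then show False by (auto simp: diff_eq_0_iff_ennreal)
    qed
  qed
  then show ?thesis by (simp add: f_def)
qed

text \<open>From below, \<open>ln (1 / x) \<le> 1 / x - 1\<close> gives
  \<open>x * ln x \<ge> -1\<close>. From above, \<open>x * ln x\<close> is nonpositive up to
  \<open>1\<close> and monotone afterwards, so it is at most \<open>K * ln K\<close>. The bound adds
  the two.\<close>

lemma abs_mult_log_le: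
  fixes x :: real
  assumes "0 \<le> x" "x \<le> K" "1 \<le> K" "1 < b"
  shows "\<bar>x * log b x\<bar> \<le> (1 + K * ln K) / ln b"
proof (cases "x = 0")
  case True
  with assms show ?thesis by (simp add: divide_nonneg_nonneg)
next
  case False
  then have x: "0 < x" using assms by simp
  have "ln (1 / x) \<le> 1 / x - 1" by (rule ln_le_minus_one) (use x in simp)
  then have "x * (- ln x) \<le> x * (1 / x - 1)" using x by (intro mult_left_mono) (simp_all add: ln_div)
  then have lower: "- (x * ln x) \<le> 1" using x by (simp add: right_diff_distrib)
  have upper: "x * ln x \<le> K * ln K"
  proof (cases "x \<le> 1")
    case True
    then have "x * ln x \<le> 0" using x by (simp add: mult_nonneg_nonpos)
    also have "0 \<le> K * ln K" using assms by simp
    finally show ?thesis .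
  qed (use assms in \<open>auto intro!: mult_mono\<close>)
  have "0 \<le> K * ln K" using assms by simp
  then have "\<bar>x * ln x\<bar> \<le> 1 + K * ln K" using lower upper by linarith
  then show ?thesis
    using assms by (simp add: log_def abs_mult divide_right_mono)
qed

text \<open>With \<open>D\<close> the density of \<open>N\<close>, integrability of
  \<open>log b D\<close> under \<open>N\<close> is integrability of \<open>D * log b D\<close> under
  \<open>M\<close>. Domination confines \<open>D\<close> to \<open>[0, K]\<close>, where that
  function is bounded, and \<open>M\<close> is finite.\<close>

lemma (in information_space) integrable_entropy_density_dominated:
  assumes N: "prob_space N" "sets N = sets M" and ac: "absolutely_continuous M N"
    and le: "\<And>A. A \<in> sets M \<Longrightarrow> emeasure N A \<le> ennreal K * emeasure M A"
    and K: "1 \<le> K"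
  shows "integrable N (entropy_density b M N)"
proof -
  interpret N: prob_space N by fact
  have fin: "finite_measure N" by unfold_locales
  from real_RN_deriv[OF fin ac N(2)] obtain D where D:
      "D \<in> borel_measurable M" "AE x in M. RN_deriv M N x = ennreal (D x)"
      "AE x in N. 0 < D x" "\<And>x. 0 \<le> D x"
    by blast
  have "N = density M (RN_deriv M N)"
    using ac N(2) by (rule density_RN_deriv[symmetric])
  also have "\<dots> = density M D"
    using D by (auto intro!: density_cong)
  finally have N_eq: "N = density M D" .
  have "AE x in M. D x \<le> K"
    using AE_RN_deriv_le[OF fin N(2) ac, of K, OF le] D(2)
    by (auto simp: ennreal_le_iff[OF order_trans[OF zero_le_one K]])
  then have "AE x in M. norm (D x * log b (D x)) \<le> (1 + K * ln K) / ln b"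
    by eventually_elim (use abs_mult_log_le D(4) K b_gt_1 in simp)
  then have "integrable M (\<lambda>x. D x * log b (D x))"
    using D(1) by (intro integrable_const_bound) auto
  then have "integrable N (\<lambda>x. log b (D x))"
    unfolding N_eq using D b_gt_1 by (subst integrable_real_density) auto
  moreover have "AE x in N. entropy_density b M N x = log b (D x)"
    using absolutely_continuous_AE[OF N(2) ac D(2)] D(4)
    by (auto simp: entropy_density_def)
  moreover have "entropy_density b M N \<in> borel_measurable N" "(\<lambda>x. log b (D x)) \<in> borel_measurable N"
    using D(1) measurable_entropy_density[of b M N] b_gt_1
      by (auto simp: measurable_cong_sets[OF N(2) refl])
  ultimately show ?thesis
    by (subst integrable_cong_AE) auto
qed

text \<open>A Bochner integral is \<open>0\<close> for non-integrable functions, so vanishing mutual information is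
  informative only once the entropy density is known to be integrable. For \<open>Y\<close> with finite range the joint
  law is at most a constant times the product of the marginals, and this suffices.\<close>

lemma (in information_space) distr_pair_eq_of_mutual_information_0:
  assumes V[measurable]: "V \<in> M \<rightarrow>\<^sub>M S" and Y[measurable]: "Y \<in> M \<rightarrow>\<^sub>M T"
    and fin: "finite (Y ` space M)" and sing: "\<And>y. y \<in> Y ` space M \<Longrightarrow> {y} \<in> sets T"
    and MI: "mutual_information b S T V Y = 0"
  shows "distr M (S \<Otimes>\<^sub>M T) (\<lambda>x. (V x, Y x)) = distr M S V \<Otimes>\<^sub>M distr M T Y"
proof -
  interpret V: prob_space "distr M S V" by (rule prob_space_distr) fact
  interpret Y: prob_space "distr M T Y" by (rule prob_space_distr) fact
  interpret VY: pair_prob_space "distr M S V" "distr M T Y" by standard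
  define P where "P = distr M S V \<Otimes>\<^sub>M distr M T Y"
  interpret P: information_space P b
    unfolding P_def by standard (rule b_gt_1)
  define Q where "Q = distr M (S \<Otimes>\<^sub>M T) (\<lambda>x. (V x, Y x))"
  interpret Q: prob_space Q unfolding Q_def by (rule prob_space_distr) simp
  have sets_P: "sets P = sets (S \<Otimes>\<^sub>M T)" unfolding P_def by (rule sets_pair_measure_cong) simp_all
  have sets_QP: "sets Q = sets P" by (simp add: Q_def sets_P)
  let ?R = "Y ` space M"
  define p where "p y = prob (Y -` {y} \<inter> space M)" for y
  have p_sets: "Y -` {y} \<inter> space M \<in> sets M" if "y \<in> ?R" for y
    using sing[OF that] by measurable
  \<comment> \<open>For a value of positive probability, \<open>1 / p y\<close> is one of the
    summands, whence \<open>1 \<le> K * p y\<close>; values of probability zero contribute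
    \<open>1 / 0 = 0\<close>. The leading \<open>1\<close> secures \<open>1 \<le> K\<close>.\<close>
  define K where "K = 1 + (\<Sum>y\<in>?R. 1 / p y)"
  have p_nn: "0 \<le> p y" for y by (simp add: p_def)
  have K1: "1 \<le> K" by (auto simp: K_def p_nn intro!: sum_nonneg)
  have Kp: "1 \<le> K * p y" if "y \<in> ?R" "p y \<noteq> 0" for y
  proof -
    have "1 / p y \<le> (\<Sum>y\<in>?R. 1 / p y)"
      using that fin by (intro member_le_sum) (auto simp: p_nn)
    then have "1 / p y \<le> K" by (simp add: K_def)
    then show ?thesis using that p_nn[of y] by (simp add: field_simps)
  qed
  \<comment> \<open>Slice \<open>A\<close> along the finitely many values of \<open>Y\<close>. A
    slice has joint probability at most that of \<open>V \<in> B y\<close>, which is at most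
    \<open>K * p y\<close> times itself unless \<open>p y = 0\<close>, and then the joint
    probability is zero as well.\<close>
  have le: "emeasure Q A \<le> ennreal K * emeasure P A" if A: "A \<in> sets P" for A
  proof -
    have A'[measurable]: "A \<in> sets (S \<Otimes>\<^sub>M T)" using A by (simp add: sets_P)
    define B where "B y = (\<lambda>v. (v, y)) -` A \<inter> space S" for y
    have B[measurable]: "B y \<in> sets S" if "y \<in> ?R" for y
      unfolding B_def using sets_Pair2[OF A', of y] sets.sets_into_space[OF A']
      by (auto simp: space_pair_measure vimage_def intro: sets.Int)
    define C where "C y = V -` B y \<inter> space M" for y
    have C: "C y \<in> sets M" if "y \<in> ?R" for y
      unfolding C_def using B[OF that] by measurable
    have "emeasure Q A = emeasure M ((\<lambda>x. (V x, Y x)) -` A \<inter> space M)"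
      by (simp add: Q_def emeasure_distr)
    also have "(\<lambda>x. (V x, Y x)) -` A \<inter> space M = (\<Union>y\<in>?R. C y \<inter> (Y -` {y} \<inter> space M))"
      using measurable_space[OF V] by (auto simp: C_def B_def)
    also have "emeasure M \<dots> = (\<Sum>y\<in>?R. emeasure M (C y \<inter> (Y -` {y} \<inter> space M)))"
      using C p_sets fin by (intro sum_emeasure[symmetric]) (auto simp: disjoint_family_on_def)
    also have "\<dots> \<le> (\<Sum>y\<in>?R. ennreal K * (emeasure M (C y) * ennreal (p y)))"
    proof (rule sum_mono)
      fix y assume y: "y \<in> ?R"
      show "emeasure M (C y \<inter> (Y -` {y} \<inter> space M)) \<le> ennreal K * (emeasure M (C y) * ennreal (p y))"
      proof (cases "p y = 0")
        case True
        have "emeasure M (C y \<inter> (Y -` {y} \<inter> space M)) \<le> emeasure M (Y -` {y} \<inter> space M)"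
          using p_sets[OF y] by (intro emeasure_mono) auto
        also have "\<dots> = 0" using True by (simp add: p_def emeasure_eq_measure)
        finally show ?thesis by simp
      next
        case False
        have "emeasure M (C y \<inter> (Y -` {y} \<inter> space M)) \<le> emeasure M (C y)"
          using C[OF y] by (intro emeasure_mono) auto
        also have "\<dots> \<le> ennreal (K * (measure M (C y) * p y))"
          using mult_left_mono[OF Kp[OF y False], of "measure M (C y)"]
          by (auto simp: emeasure_eq_measure ac_simps intro!: ennreal_leI)
        also have "\<dots> = ennreal K * (emeasure M (C y) * ennreal (p y))"
          using K1 p_nn by (simp add: emeasure_eq_measure ennreal_mult)
        finally show ?thesis .
      qed
    qed
    also have "\<dots> = ennreal K * (\<Sum>y\<in>?R. emeasure P (B y \<times> {y}))"
      unfolding P_def sum_distrib_left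
      by (intro sum.cong refl)
        (use B sing in \<open>simp add: Y.emeasure_pair_measure_Times emeasure_distr C_def p_def emeasure_eq_measure\<close>)
    also have "(\<Sum>y\<in>?R. emeasure P (B y \<times> {y})) = emeasure P (\<Union>y\<in>?R. B y \<times> {y})"
      using B sing fin
      by (intro sum_emeasure) (auto simp: disjoint_family_on_def sets_P image_subset_iff intro: pair_measureI)
    \<comment> \<open>\<open>A\<close> may contain points whose second component lies outside the
      range of \<open>Y\<close>, hence only an inequality.\<close>
    also have "\<dots> \<le> emeasure P A"
      using A by (intro emeasure_mono) (auto simp: B_def)
    finally show ?thesis by (simp add: mult_left_mono)
  qed
  have ac: "absolutely_continuous P Q"
    unfolding absolutely_continuous_def
  proof
    fix A assume A: "A \<in> null_sets P"
    then have "emeasure Q A \<le> ennreal K * 0" using le[of A] by (auto simp: null_sets_def)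
    then show "A \<in> null_sets Q" using A by (auto simp: null_sets_def sets_QP)
  qed
  have "integrable Q (entropy_density b P Q)"
    using ac le K1 sets_QP by (intro P.integrable_entropy_density_dominated Q.prob_space_axioms) auto
  moreover have "KL_divergence b P Q = 0"
    using MI by (simp add: mutual_information_def P_def Q_def)
  ultimately show ?thesis
    using P.KL_eq_0_iff_eq_ac[OF Q.prob_space_axioms ac sets_QP] by (simp add: P_def Q_def)
qed

text \<open>Fubini, with the outer integral written as an average over \<open>R\<close>. It reduces
  events of the joint law to events of the randomness alone.\<close>

lemma nn_integral_uniform_pair:
  assumes "sigma_finite_measure N" and R: "finite R" "R \<noteq> {}" "R \<subseteq> A"
    and f[measurable]: "f \<in> borel_measurable (uniform_measure (count_space A) R \<Otimes>\<^sub>M N)"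
  shows "(\<integral>\<^sup>+\<omega>. f \<omega> \<partial>(uniform_measure (count_space A) R \<Otimes>\<^sub>M N))
    = (\<Sum>x\<in>R. \<integral>\<^sup>+t. f (x, t) \<partial>N) / of_nat (card R)"
proof -
  interpret sigma_finite_measure N by fact
  have "(\<integral>\<^sup>+\<omega>. f \<omega> \<partial>(uniform_measure (count_space A) R \<Otimes>\<^sub>M N))
    = (\<integral>\<^sup>+x. \<integral>\<^sup>+t. f (x, t) \<partial>N \<partial>uniform_measure (count_space A) R)"
    by (rule nn_integral_fst[symmetric]) measurable
  also have "\<dots> = (\<integral>\<^sup>+x. (\<integral>\<^sup>+t. f (x, t) \<partial>N) * indicator R x \<partial>count_space A) / emeasure (count_space A) R"
    using R by (intro nn_integral_uniform_measure) auto
  also have "emeasure (count_space A) R = of_nat (card R)"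
    using R by (simp add: emeasure_count_space_finite)
  also have "(\<integral>\<^sup>+x. (\<integral>\<^sup>+t. f (x, t) \<partial>N) * indicator R x \<partial>count_space A)
      = (\<Sum>x\<in>R. (\<integral>\<^sup>+t. f (x, t) \<partial>N) * indicator R x)"
    using R by (intro nn_integral_count_space') auto
  also have "\<dots> = (\<Sum>x\<in>R. \<integral>\<^sup>+t. f (x, t) \<partial>N)"
    by (intro sum.cong) auto
  finally show ?thesis .
qed

section \<open>Sums of one-hot vectors\<close>

lemma vsum_swap:
  assumes "finite I" "i \<in> I" "j \<in> I" "i \<noteq> j"
  shows "vsum I (x(i := a, j := b)) = vsum I (x(i := b, j := a))"
proof -
  have "vsum I (x(i := a, j := b)) l = a l + (b l + (\<Sum>k\<in>I - {i} - {j}. x k l))" for a b l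
    using assms by (simp add: vsum_def sum.remove[of I i] sum.remove[of "I - {i}" j])
  then show ?thesis by (simp add: fun_eq_iff add.left_commute)
qed

lemma data_updI: "x \<in> data d I \<Longrightarrow> i \<in> I \<Longrightarrow> v \<in> one_hots d \<Longrightarrow> x(i := v) \<in> data d I"
  by (auto simp: data_def PiE_iff extensional_def)

text \<open>Updating coordinate \<open>j\<close> reduces to updating coordinate \<open>i\<close>: transpose the two entries, which
  preserves the sum, update, and transpose back.\<close>

lemma data_function_const:
  assumes I: "finite I" "i \<in> I"
    and sum: "\<And>x y. x \<in> data d I \<Longrightarrow> y \<in> data d I \<Longrightarrow> vsum I x = vsum I y \<Longrightarrow> F x = F y"
    and upd: "\<And>x v. x \<in> data d I \<Longrightarrow> v \<in> one_hots d \<Longrightarrow> F (x(i := v)) = F x"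
    and x: "x \<in> data d I" and y: "y \<in> data d I"
  shows "F x = F y"
proof -
  have upd_any: "F (x(j := v)) = F x" if x: "x \<in> data d I" and v: "v \<in> one_hots d" and j: "j \<in> I" for x v j
  proof (cases "j = i")
    case False
    have mem: "x i \<in> one_hots d" "x j \<in> one_hots d" using x I j by (auto simp: data_def)
    have "F (x(j := v)) = F (x(i := x i, j := v))" by simp
    also have "\<dots> = F (x(i := v, j := x i))"
      using False x v j I mem by (intro sum vsum_swap) (auto intro!: data_updI)
    also have "\<dots> = F ((x(i := x j, j := x i))(i := v))"
      using False by (simp add: fun_upd_twist)
    also have "\<dots> = F (x(i := x j, j := x i))"
      using x v j I mem by (intro upd) (auto intro!: data_updI)
    also have "\<dots> = F (x(i := x i, j := x j))"
      using False x v j I mem by (intro sum vsum_swap) (auto intro!: data_updI simp del: fun_upd_triv)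
    finally show ?thesis by simp
  qed (use upd x v in simp)
  \<comment> \<open>Interpolate from \<open>x\<close> to \<open>y\<close>, replacing one coordinate
    at a time; every intermediate point must stay in \<open>data d I\<close>.\<close>
  have "override_on x y A \<in> data d I \<and> F (override_on x y A) = F x" if "finite A" "A \<subseteq> I" for A
    using that
  proof (induction A rule: finite_induct)
    case empty
    then show ?case using x by simp
  next
    case (insert j A)
    have "override_on x y (insert j A) = (override_on x y A)(j := y j)"
      by (rule override_on_insert)
    moreover have "y j \<in> one_hots d" using y insert by (auto simp: data_def)
    ultimately show ?case
      using insert upd_any[of "override_on x y A" "y j" j] data_updI[of "override_on x y A" d I j "y j"]
      by (simp del: fun_upd_apply)
  qed
  from this[of I] have "F (override_on x y I) = F x" using I by simp
  \<comment> \<open>Both functions are \<open>undefined\<close> outside \<open>I\<close>, so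
    agreement on \<open>I\<close> is equality.\<close>
  moreover have "override_on x y I = y"
    using x y by (auto simp: override_on_def data_def PiE_iff extensional_def fun_eq_iff)
  ultimately show ?thesis by simp
qed

section \<open>Counting the possible sums\<close>

lemma finite_one_hots: "finite (one_hots d)"
  by (simp add: one_hots_def)

lemma card_one_hots: "card (one_hots d) = d"
proof -
  have "inj one_hot"
  proof (rule injI)
    fix k l assume "one_hot k = one_hot l"
    then have "one_hot k k = one_hot l k" by simp
    then show "k = l" by (simp add: one_hot_def split: if_splits)
  qed
  then show ?thesis
    unfolding one_hots_def by (subst card_image) (auto intro: inj_on_subset)
qed

lemma finite_data: "finite I \<Longrightarrow> finite (data d I)"
  by (simp add: data_def finite_PiE finite_one_hots)

lemma card_data: "finite I \<Longrightarrow> card (data d I) = d ^ card I"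
  by (simp add: data_def card_PiE card_one_hots)

text \<open>The position of the one in \<open>y i\<close> is nonzero in the common sum, so some
  \<open>x j\<close> is nonzero there, and a one-hot vector is determined by such a
  position.\<close>

lemma one_hot_mem_of_vsum_eq:
  assumes I: "finite I" and x: "x \<in> data d I" and y: "y \<in> data d I"
    and eq: "vsum I x = vsum I y" and i: "i \<in> I"
  shows "y i \<in> x ` I"
proof -
  from y i obtain k where k: "y i = one_hot k" by (auto simp: data_def one_hots_def PiE_iff)
  have "1 \<le> vsum I y k"
    unfolding vsum_def using member_le_sum[of i I "\<lambda>i. y i k"] I i k by (simp add: one_hot_def)
  then have "vsum I x k \<noteq> 0" using eq by simp
  then obtain j where j: "j \<in> I" "x j k \<noteq> 0" using I by (auto simp: vsum_def)
  then obtain l where "x j = one_hot l" using x by (auto simp: data_def one_hots_def PiE_iff)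
  with j k show ?thesis by (auto simp: one_hot_def split: if_splits intro!: image_eqI[of _ _ j])
qed

text \<open>All members of a fibre of \<open>vsum I\<close> take their entries from those of one
  fixed member, at most \<open>card I\<close> vectors. This crude bound on the fibres costs only a
  term \<open>n * log n\<close> after taking logarithms.\<close>

lemma card_vsum_image_ge:
  assumes I: "finite I"
  shows "d ^ card I \<le> card (vsum I ` data d I) * card I ^ card I"
proof -
  define F where "F s = {x \<in> data d I. vsum I x = s}" for s
  have fib: "card (F s) \<le> card I ^ card I" for s
  proof (cases "F s = {}")
    case False
    then obtain x where x: "x \<in> data d I" "vsum I x = s" by (auto simp: F_def)
    have "F s \<subseteq> I \<rightarrow>\<^sub>E x ` I"
      using one_hot_mem_of_vsum_eq[OF I x(1)] x(2) by (auto simp: F_def data_def PiE_iff extensional_def)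
    then have "card (F s) \<le> card (I \<rightarrow>\<^sub>E x ` I)"
      using I by (intro card_mono) (auto intro: finite_PiE)
    also have "\<dots> = card (x ` I) ^ card I" using I by (simp add: card_PiE)
    also have "\<dots> \<le> card I ^ card I" using I by (intro power_mono card_image_le) auto
    finally show ?thesis .
  qed simp
  have "data d I = (\<Union>s\<in>vsum I ` data d I. F s)" by (auto simp: F_def)
  then have "d ^ card I = card (\<Union>s\<in>vsum I ` data d I. F s)" using card_data[OF I, of d] by simp
  also have "\<dots> \<le> (\<Sum>s\<in>vsum I ` data d I. card (F s))"
    using I by (intro card_UN_le) (simp add: finite_data)
  also have "\<dots> \<le> (\<Sum>s\<in>vsum I ` data d I. card I ^ card I)" by (intro sum_mono fib)
  finally show ?thesis by simp
qed

lemma large_dim_ge_1: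
  assumes "\<epsilon> > 0" and nd: "(n, d) \<in> large_dim \<epsilon>"
  shows "1 \<le> n" and "1 \<le> d"
proof -
  show n: "1 \<le> n" using nd by (simp add: large_dim_def)
  have "1 powr (1 + \<epsilon>) \<le> real n powr (1 + \<epsilon>)" using n assms by (intro powr_mono2) auto
  then show "1 \<le> d" using nd by (simp add: large_dim_def)
qed

text \<open>Counting gives \<open>log N \<ge> n * log d - n * log n\<close>, and the regime gives
  \<open>log n \<le> log d / (1 + \<epsilon>)\<close>. The remaining factor is
  \<open>1 - 1 / (1 + \<epsilon>) = \<epsilon> / (1 + \<epsilon>)\<close>.\<close>

lemma log_card_vsum_image_ge:
  assumes "\<epsilon> > 0" and nd: "(n, d) \<in> large_dim \<epsilon>"
  shows "\<epsilon> / (1 + \<epsilon>) * (real n * log 2 (real d)) \<le> log 2 (card (vsum {1..n} ` data d {1..n}))"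
proof -
  let ?N = "card (vsum {1..n} ` data d {1..n})"
  note n = large_dim_ge_1(1)[OF assms] and d = large_dim_ge_1(2)[OF assms]
  from nd have le: "real n powr (1 + \<epsilon>) \<le> real d" by (simp add: large_dim_def)
  have logn: "(1 + \<epsilon>) * log 2 n \<le> log 2 d"
  proof -
    have "log 2 (real n powr (1 + \<epsilon>)) \<le> log 2 d" using n le d by (intro log_mono) auto
    then show ?thesis using n by (simp add: log_powr)
  qed
  have "d ^ n \<le> ?N * n ^ n" using card_vsum_image_ge[of "{1..n}" d] by simp
  moreover from this have N: "?N > 0" using d by (cases "?N = 0") auto
  ultimately have "log 2 (real d ^ n) \<le> log 2 (real ?N * real n ^ n)"
    using n d by (subst log_le_cancel_iff) (auto simp flip: of_nat_power of_nat_mult)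
  then have "real n * log 2 d \<le> log 2 ?N + real n * log 2 n"
    using n d N by (simp add: log_mult log_nat_power)
  moreover have "real n * log 2 n \<le> real n * (log 2 d / (1 + \<epsilon>))"
    using logn assms by (intro mult_left_mono) (simp_all add: field_simps)
  ultimately have "real n * log 2 d - real n * (log 2 d / (1 + \<epsilon>)) \<le> log 2 ?N" by simp
  moreover have "\<epsilon> / (1 + \<epsilon>) * (real n * log 2 d) = real n * log 2 d - real n * (log 2 d / (1 + \<epsilon>))"
    using assms by (simp add: field_simps)
  ultimately show ?thesis by simp
qed

section \<open>Bounds on Shannon entropy\<close>

text \<open>By injectivity each value on \<open>R\<close> has mass \<open>1 / card R\<close>, and
  all other values have mass zero, where \<open>p * log 2 p\<close> is \<open>0\<close>.\<close>

lemma shannon_entropy_uniform: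
  assumes R: "finite R" "R \<noteq> {}" "R \<subseteq> A" and inj: "inj_on f R"
  shows "shannon_entropy (uniform_measure (count_space A) R) f = ennreal (log 2 (card R))"
proof -
  have p: "measure (uniform_measure (count_space A) R) (f -` {s} \<inter> A) = (if s \<in> f ` R then 1 / card R else 0)" for s
  proof -
    have "measure (uniform_measure (count_space A) R) (f -` {s} \<inter> A)
        = measure (count_space A) (R \<inter> (f -` {s} \<inter> A)) / measure (count_space A) R"
      using R by (intro measure_uniform_measure) (auto simp: emeasure_count_space_finite)
    also have "R \<inter> (f -` {s} \<inter> A) = {x \<in> R. f x = s}" using R by auto
    also have "measure (count_space A) {x \<in> R. f x = s} = card {x \<in> R. f x = s}"
      using R by (subst measure_count_space) auto
    also have "measure (count_space A) R = card R"
      using R by (subst measure_count_space) auto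
    also have "card {x \<in> R. f x = s} = (if s \<in> f ` R then 1 else 0)"
    proof (cases "s \<in> f ` R")
      case True
      then obtain x where "x \<in> R" "s = f x" by auto
      then have "{x \<in> R. f x = s} = {x}" using inj by (auto dest: inj_onD)
      then show ?thesis using True by simp
    next
      case False
      then have "{x \<in> R. f x = s} = {}" by auto
      then show ?thesis using False by (simp only: card.empty if_False)
    qed
    finally show ?thesis by simp
  qed
  have N: "card R > 0" using R by (simp add: card_gt_0_iff)
  have "shannon_entropy (uniform_measure (count_space A) R) f
      = (\<integral>\<^sup>+ s. ennreal (if s \<in> f ` R then log 2 (card R) / card R else 0) \<partial>count_space UNIV)"
    using N by (auto simp: shannon_entropy_def p Let_def log_divide intro!: nn_integral_cong)
  also have "\<dots> = (\<Sum>s\<in>f ` R. ennreal (if s \<in> f ` R then log 2 (card R) / card R else 0))"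
    using R by (intro nn_integral_count_space') auto
  also have "\<dots> = ennreal (\<Sum>s\<in>f ` R. log 2 (card R) / card R)"
    using N by (subst sum_ennreal[symmetric]) auto
  also have "(\<Sum>s\<in>f ` R. log 2 (card R) / card R) = log 2 (card R)"
    using N by (simp add: card_image[OF inj])
  finally show ?thesis .
qed

text \<open>Entropy is the mean of \<open>- log 2 p\<close>, which is at least
  \<open>log 2 N\<close> at every atom. Since the value type is countable, the atoms carry the whole
  mass.\<close>

lemma shannon_entropy_ge_log:
  fixes X :: "'a \<Rightarrow> 'b::countable"
  assumes "prob_space M" and X[measurable]: "X \<in> M \<rightarrow>\<^sub>M count_space UNIV"
    and N: "1 \<le> N" and le: "\<And>y. measure M (X -` {y} \<inter> space M) \<le> 1 / N"
  shows "ennreal (log 2 N) \<le> shannon_entropy M X"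
proof -
  interpret prob_space M by fact
  interpret X: prob_space "distr M (count_space UNIV) X" by (rule prob_space_distr) fact
  define p where "p y = measure M (X -` {y} \<inter> space M)" for y
  \<comment> \<open>Spreading \<open>log 2 N\<close> over the total mass \<open>1\<close> makes the
    comparison pointwise.\<close>
  have "ennreal (log 2 N) = ennreal (log 2 N) * emeasure (distr M (count_space UNIV) X) UNIV"
    using X.emeasure_space_1 by simp
  also have "emeasure (distr M (count_space UNIV) X) UNIV
      = (\<integral>\<^sup>+ y. emeasure (distr M (count_space UNIV) X) {y} \<partial>count_space UNIV)"
    by (rule emeasure_countable_singleton) auto
  also have "\<dots> = (\<integral>\<^sup>+ y. ennreal (p y) \<partial>count_space UNIV)"
    by (simp add: emeasure_distr p_def emeasure_eq_measure)
  also have "ennreal (log 2 N) * \<dots> = (\<integral>\<^sup>+ y. ennreal (log 2 N) * ennreal (p y) \<partial>count_space UNIV)"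
    by (rule nn_integral_cmult[symmetric]) simp
  also have "\<dots> \<le> (\<integral>\<^sup>+ y. ennreal (- p y * log 2 (p y)) \<partial>count_space UNIV)"
  proof (rule nn_integral_mono)
    fix y
    have "p y * log 2 N \<le> p y * (- log 2 (p y))" if "p y \<noteq> 0"
    proof (rule mult_left_mono)
      have pos: "0 < p y" using that by (simp add: p_def zero_less_measure_iff)
      have "log 2 (p y) \<le> log 2 (1 / N)" using pos le[of y] by (intro log_mono) (auto simp: p_def)
      then show "log 2 N \<le> - log 2 (p y)" using N by (simp add: log_divide)
    qed (simp add: p_def)
    then have "log 2 N * p y \<le> - p y * log 2 (p y)" by (cases "p y = 0") (auto simp: mult.commute)
    then show "ennreal (log 2 N) * ennreal (p y) \<le> ennreal (- p y * log 2 (p y))"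
      using N by (subst ennreal_mult[symmetric]) (auto simp: p_def intro!: ennreal_leI)
  qed
  also have "\<dots> = shannon_entropy M X" by (simp add: shannon_entropy_def p_def Let_def)
  finally show ?thesis .
qed

section \<open>The messages of a secure protocol\<close>

text \<open>The carrier stays all of \<open>data d {1..n}\<close>, as \<open>data_prior\<close>
  demands; only the mass is confined to \<open>R\<close>.\<close>

abbreviation uniform_data :: "nat \<Rightarrow> nat \<Rightarrow> (nat \<Rightarrow> vec) set \<Rightarrow> (nat \<Rightarrow> vec) measure"
  where "uniform_data n d R \<equiv> uniform_measure (count_space (data d {1..n})) R"

lemma data_prior_uniform:
  assumes "R \<noteq> {}" "R \<subseteq> data d {1..n}"
  shows "data_prior n d (uniform_data n d R)"
proof -
  have "finite R" using assms finite_data[of "{1..n}" d] by (auto intro: finite_subset)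
  then show ?thesis
    using assms unfolding data_prior_def
    by (auto intro!: prob_space_uniform_measure simp: emeasure_count_space_finite)
qed

context
  fixes n d :: nat and pr :: "('t, 'y::countable, 'h) protocol"
  assumes prot: "aggregation_protocol n d pr"
  notes [simp del] = One_nat_def
begin

section \<open>The joint law of data and randomness\<close>

lemma prob_space_rand_law: "prob_space (rand_law pr)"
  using prot by (simp add: aggregation_protocol_def)

lemma prob_space_joint:
  assumes "data_prior n d P"
  shows "prob_space (joint P pr)"
proof -
  interpret P: prob_space P using assms by (simp add: data_prior_def)
  interpret Q: prob_space "rand_law pr" by (rule prob_space_rand_law)
  interpret PQ: pair_prob_space P "rand_law pr" by standard
  show ?thesis unfolding joint_def by (rule PQ.prob_space_axioms)
qed

lemma space_joint:
  assumes "data_prior n d P"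
  shows "space (joint P pr) = data d {1..n} \<times> space (rand_law pr)"
  using assms sets_eq_imp_space_eq[of P "count_space (data d {1..n})"]
  by (simp add: joint_def space_pair_measure data_prior_def)

text \<open>The data space is finite and discrete, so measurability can be checked for each fixed
  value of the data.\<close>

lemma measurable_joint:
  assumes P: "data_prior n d P"
    and f: "\<And>x. x \<in> data d {1..n} \<Longrightarrow> (\<lambda>t. f (x, t)) \<in> rand_law pr \<rightarrow>\<^sub>M K"
  shows "f \<in> joint P pr \<rightarrow>\<^sub>M K"
proof -
  have "sets (joint P pr) = sets (count_space (data d {1..n}) \<Otimes>\<^sub>M rand_law pr)"
    unfolding joint_def using P by (intro sets_pair_measure_cong) (auto simp: data_prior_def)
  moreover have "f \<in> count_space (data d {1..n}) \<Otimes>\<^sub>M rand_law pr \<rightarrow>\<^sub>M K"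
    using f by (intro measurable_pair_measure_countable1) (auto simp: finite_data countable_finite)
  ultimately show ?thesis by (simp cong: measurable_cong_sets)
qed

lemma measurable_enc:
  assumes x: "x \<in> data d {1..n}" and i: "i \<in> {1..n}"
  shows "(\<lambda>t. enc pr i (x i) (t i)) \<in> rand_law pr \<rightarrow>\<^sub>M count_space UNIV"
proof -
  have sets: "sets (rand_law pr) = sets (PiM {1..n} (rand_space pr))"
    using prot by (simp add: aggregation_protocol_def)
  have [measurable]: "enc pr i (x i) \<in> rand_space pr i \<rightarrow>\<^sub>M count_space UNIV"
    using prot i PiE_mem[OF x[unfolded data_def] i] unfolding aggregation_protocol_def by blast
  have "(\<lambda>t. enc pr i (x i) (t i)) \<in> PiM {1..n} (rand_space pr) \<rightarrow>\<^sub>M count_space UNIV"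
    using i by measurable
  then show ?thesis by (simp add: measurable_cong_sets[OF sets refl])
qed

lemma measurable_msgs:
  assumes "x \<in> data d {1..n}" "A \<subseteq> {1..n}"
  shows "(\<lambda>t. msgs pr A (x, t)) \<in> rand_law pr \<rightarrow>\<^sub>M PiM A (\<lambda>_. count_space UNIV)"
  unfolding msgs_def msg_def using assms by (auto intro!: measurable_restrict measurable_enc)

lemma measurable_round2:
  "Dr \<subseteq> {1..n} \<Longrightarrow> (\<lambda>t. round2 pr t Dr) \<in> rand_law pr \<rightarrow>\<^sub>M round2_space pr"
  using prot by (simp add: aggregation_protocol_def)

lemma emeasure_joint_uniform:
  assumes R: "R \<noteq> {}" "R \<subseteq> data d {1..n}" and E: "E \<in> sets (joint (uniform_data n d R) pr)"
  shows "emeasure (joint (uniform_data n d R) pr) E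
    = (\<Sum>x\<in>R. emeasure (rand_law pr) {t \<in> space (rand_law pr). (x, t) \<in> E}) / of_nat (card R)"
proof -
  interpret Q: prob_space "rand_law pr" by (rule prob_space_rand_law)
  have fin: "finite R" using R finite_data[of "{1..n}" d] by (auto intro: finite_subset)
  have E': "E \<in> sets (uniform_data n d R \<Otimes>\<^sub>M rand_law pr)" using E by (simp add: joint_def)
  have "emeasure (joint (uniform_data n d R) pr) E = (\<integral>\<^sup>+\<omega>. indicator E \<omega> \<partial>joint (uniform_data n d R) pr)"
    using E by simp
  also have "\<dots> = (\<Sum>x\<in>R. \<integral>\<^sup>+t. indicator E (x, t) \<partial>rand_law pr) / of_nat (card R)"
    unfolding joint_def using R fin E'
    by (intro nn_integral_uniform_pair) (auto intro: Q.sigma_finite_measure_axioms)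
  also have "(\<integral>\<^sup>+t. indicator E (x, t) \<partial>rand_law pr)
      = emeasure (rand_law pr) {t \<in> space (rand_law pr). (x, t) \<in> E}" if "x \<in> R" for x
  proof -
    have "{t \<in> space (rand_law pr). (x, t) \<in> E} = Pair x -` E"
      using sets.sets_into_space[OF E'] by (auto simp: space_pair_measure)
    then have "{t \<in> space (rand_law pr). (x, t) \<in> E} \<in> sets (rand_law pr)"
      using sets_Pair1[OF E'] by simp
    then have "emeasure (rand_law pr) {t \<in> space (rand_law pr). (x, t) \<in> E}
        = (\<integral>\<^sup>+t. indicator {t \<in> space (rand_law pr). (x, t) \<in> E} t \<partial>rand_law pr)"
      by (rule nn_integral_indicator[symmetric])
    also have "\<dots> = (\<integral>\<^sup>+t. indicator E (x, t) \<partial>rand_law pr)"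
      by (rule nn_integral_cong) (simp split: split_indicator)
    finally show ?thesis by (rule sym)
  qed
  then have "(\<Sum>x\<in>R. \<integral>\<^sup>+t. indicator E (x, t) \<partial>rand_law pr)
      = (\<Sum>x\<in>R. emeasure (rand_law pr) {t \<in> space (rand_law pr). (x, t) \<in> E})"
    by (rule sum.cong[OF refl])
  finally show ?thesis .
qed

text \<open>For events that fix the data to \<open>v\<close>, a single term of the average
  survives.\<close>

lemma emeasure_joint_uniform_single:
  assumes R: "R \<noteq> {}" "R \<subseteq> data d {1..n}" and v: "v \<in> R"
    and E: "E \<in> sets (joint (uniform_data n d R) pr)" and single: "\<And>u t. u \<noteq> v \<Longrightarrow> (u, t) \<notin> E"
  shows "emeasure (joint (uniform_data n d R) pr) E
    = emeasure (rand_law pr) {t \<in> space (rand_law pr). (v, t) \<in> E} / of_nat (card R)"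
proof -
  have fin: "finite R" using R finite_data[of "{1..n}" d] by (auto intro: finite_subset)
  have "(\<Sum>x\<in>R. emeasure (rand_law pr) {t \<in> space (rand_law pr). (x, t) \<in> E})
      = (\<Sum>x\<in>{v}. emeasure (rand_law pr) {t \<in> space (rand_law pr). (x, t) \<in> E})"
    using fin v single by (intro sum.mono_neutral_right) auto
  then show ?thesis by (simp add: emeasure_joint_uniform[OF R E])
qed

lemma AE_joint_uniform_fst:
  assumes R: "R \<noteq> {}" "R \<subseteq> data d {1..n}"
  shows "AE \<omega> in joint (uniform_data n d R) pr. fst \<omega> \<in> R"
proof -
  have P: "data_prior n d (uniform_data n d R)" by (rule data_prior_uniform) fact+
  have "(\<lambda>\<omega>. fst \<omega> \<in> R) \<in> joint (uniform_data n d R) pr \<rightarrow>\<^sub>M count_space UNIV"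
    by (intro measurable_joint[OF P]) simp
  then have N: "{\<omega> \<in> space (joint (uniform_data n d R) pr). \<not> fst \<omega> \<in> R} \<in> sets (joint (uniform_data n d R) pr)"
    by simp
  have "emeasure (joint (uniform_data n d R) pr) {\<omega> \<in> space (joint (uniform_data n d R) pr). \<not> fst \<omega> \<in> R} = 0"
    using R by (subst emeasure_joint_uniform[OF R N]) simp
  with N show ?thesis by (intro AE_I[OF subset_refl])
qed

section \<open>Consequences of security for the law of the messages\<close>

text \<open>Under the uniform prior on \<open>x\<close> and \<open>y\<close> the sum is constant, so
  conditioning on it is void and (S1) makes the view independent of the data. Fixing the data to
  \<open>x\<close> or to \<open>y\<close> then yields the same law.\<close>

lemma distr_msgs_eq_of_vsum_eq:
  assumes sec: "secure_given_sum n d pr"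
    and x: "x \<in> data d {1..n}" "y \<in> data d {1..n}" and eq: "vsum {1..n} x = vsum {1..n} y"
  shows "distr (rand_law pr) (PiM {1..n} (\<lambda>_. count_space UNIV)) (\<lambda>t. msgs pr {1..n} (x, t))
    = distr (rand_law pr) (PiM {1..n} (\<lambda>_. count_space UNIV)) (\<lambda>t. msgs pr {1..n} (y, t))"
proof -
  define I where "I = {1..n}"
  \<comment> \<open>This is a single point when \<open>x = y\<close>; hence \<open>card R\<close>
    instead of \<open>2\<close> below.\<close>
  define R where "R = {x, y}"
  define J where "J = joint (uniform_data n d R) pr"
  define s where "s = vsum I x"
  have R: "R \<noteq> {}" "R \<subseteq> data d {1..n}" using x by (auto simp: R_def)
  have P: "data_prior n d (uniform_data n d R)" by (rule data_prior_uniform) fact+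
  interpret Q: prob_space "rand_law pr" by (rule prob_space_rand_law)
  interpret J: prob_space J unfolding J_def by (rule prob_space_joint[OF P])
  interpret J: information_space J 2 by standard simp
  define V where "V = server_view pr n {}"
  define X where "X = (\<lambda>\<omega> :: (nat \<Rightarrow> vec) \<times> (nat \<Rightarrow> 't). restrict (fst \<omega>) I)"
  define Z where "Z = (\<lambda>\<omega> :: (nat \<Rightarrow> vec) \<times> (nat \<Rightarrow> 't). vsum I (fst \<omega>))"
  define S where "S = view_space pr n {}"
  define T where "T = count_space (data d I) \<Otimes>\<^sub>M (count_space UNIV :: vec measure)"
  have sing_T: "{(v, vsum I v)} \<in> sets T" if "v \<in> data d I" for v
  proof -
    have "{v} \<times> {vsum I v} \<in> sets T" using that unfolding T_def by (intro pair_measureI) auto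
    then show ?thesis by simp
  qed
  have space_J: "space J = data d I \<times> space (rand_law pr)"
    unfolding J_def I_def by (rule space_joint[OF P])
  have X_eq: "X (v, t) = v" if "v \<in> data d I" for v t
    using that by (auto simp: X_def data_def PiE_iff extensional_restrict)
  have V[measurable]: "V \<in> J \<rightarrow>\<^sub>M S"
    unfolding J_def V_def S_def view_space_def server_view_def
    by (intro measurable_joint[OF P] measurable_Pair)
      (auto intro!: measurable_msgs measurable_round2)
  have Z[measurable]: "Z \<in> J \<rightarrow>\<^sub>M count_space UNIV"
    unfolding J_def Z_def by (intro measurable_joint[OF P]) simp
  have X[measurable]: "X \<in> J \<rightarrow>\<^sub>M count_space (data d I)"
    unfolding J_def by (intro measurable_joint[OF P]) (simp add: X_eq I_def)
  have AE_Z: "AE \<omega> in J. Z \<omega> = s"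
    using AE_joint_uniform_fst[OF R] unfolding J_def[symmetric]
    by eventually_elim (use eq in \<open>auto simp: R_def Z_def s_def I_def\<close>)
  interpret V: prob_space "distr J S V" by (rule J.prob_space_distr) fact
  interpret Z: prob_space "distr J (count_space UNIV) Z" by (rule J.prob_space_distr) fact
  interpret VZ: pair_prob_space "distr J S V" "distr J (count_space UNIV) Z" by standard
  \<comment> \<open>An almost surely constant variable is independent of every other one: on a
    rectangle \<open>A \<times> B\<close> both sides are the probability of \<open>V \<in> A\<close>
    if \<open>s \<in> B\<close>, and \<open>0\<close> otherwise.\<close>
  have VZ: "distr J S V \<Otimes>\<^sub>M distr J (count_space UNIV) Z
      = distr J (S \<Otimes>\<^sub>M count_space UNIV) (\<lambda>\<omega>. (V \<omega>, Z \<omega>))"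
  proof (rule pair_measure_eqI)
    show "sigma_finite_measure (distr J S V)" "sigma_finite_measure (distr J (count_space UNIV) Z)"
      by (rule V.sigma_finite_measure_axioms Z.sigma_finite_measure_axioms)+
    show "sets (distr J S V \<Otimes>\<^sub>M distr J (count_space UNIV) Z)
        = sets (distr J (S \<Otimes>\<^sub>M count_space UNIV) (\<lambda>\<omega>. (V \<omega>, Z \<omega>)))"
      unfolding sets_distr by (rule sets_pair_measure_cong) simp_all
    fix A B assume A: "A \<in> sets (distr J S V)" and "B \<in> sets (distr J (count_space UNIV) Z)"
    have [measurable]: "A \<in> sets S" using A by simp
    have B: "emeasure J (Z -` B \<inter> space J) = indicator B s"
    proof -
      have "emeasure J (Z -` B \<inter> space J) = emeasure J (if s \<in> B then space J else {})"
        using AE_Z by (intro emeasure_eq_AE) auto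
      then show ?thesis by (simp add: J.emeasure_space_1)
    qed
    have AB: "emeasure J ((\<lambda>\<omega>. (V \<omega>, Z \<omega>)) -` (A \<times> B) \<inter> space J)
        = emeasure J (if s \<in> B then V -` A \<inter> space J else {})"
      using AE_Z by (intro emeasure_eq_AE) (auto, measurable)
    show "emeasure (distr J S V) A * emeasure (distr J (count_space UNIV) Z) B
        = emeasure (distr J (S \<Otimes>\<^sub>M count_space UNIV) (\<lambda>\<omega>. (V \<omega>, Z \<omega>))) (A \<times> B)"
      by (simp add: emeasure_distr AB B)
  qed
  have "J.mutual_information 2 S (count_space UNIV) V Z = 0"
    unfolding J.mutual_information_def VZ[symmetric] by (rule VZ.KL_same_eq_0)
  moreover have "J.conditional_mutual_information 2 S (count_space (data d I)) (count_space UNIV) V X Z = 0"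
    using sec[unfolded secure_given_sum_def, rule_format, OF P empty_subsetI]
    by (simp add: J_def S_def V_def X_def Z_def I_def)
  \<comment> \<open>Conditional mutual information is by definition the information of
    \<open>V\<close> about \<open>(X, Z)\<close> minus that about \<open>Z\<close>, and the latter
    has just been shown to vanish.\<close>
  ultimately have MI: "J.mutual_information 2 S T V (\<lambda>\<omega>. (X \<omega>, Z \<omega>)) = 0"
    by (simp add: J.conditional_mutual_information_def T_def)
  have XZ[measurable]: "(\<lambda>\<omega>. (X \<omega>, Z \<omega>)) \<in> J \<rightarrow>\<^sub>M T" unfolding T_def by measurable
  interpret XZ: prob_space "distr J T (\<lambda>\<omega>. (X \<omega>, Z \<omega>))" by (rule J.prob_space_distr) fact
  have indep: "distr J (S \<Otimes>\<^sub>M T) (\<lambda>\<omega>. (V \<omega>, (X \<omega>, Z \<omega>)))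
      = distr J S V \<Otimes>\<^sub>M distr J T (\<lambda>\<omega>. (X \<omega>, Z \<omega>))"
  proof (rule J.distr_pair_eq_of_mutual_information_0[OF V XZ _ _ MI])
    have "(\<lambda>\<omega>. (X \<omega>, Z \<omega>)) ` space J \<subseteq> (\<lambda>v. (v, vsum I v)) ` data d I"
      by (auto simp: space_J X_eq Z_def)
    then show "finite ((\<lambda>\<omega>. (X \<omega>, Z \<omega>)) ` space J)"
      by (rule finite_subset) (simp add: finite_data I_def)
    fix q assume "q \<in> (\<lambda>\<omega>. (X \<omega>, Z \<omega>)) ` space J"
    then obtain v where "v \<in> data d I" "q = (v, vsum I v)" by (auto simp: space_J X_eq Z_def)
    then show "{q} \<in> sets T" by (simp add: sing_T)
  qed
  \<comment> \<open>The right-hand side does not depend on \<open>v\<close>, which gives the claim.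
    Independence is evaluated on the event that the messages lie in \<open>C\<close> and the data
    equal \<open>v\<close>; the latter has probability \<open>1 / card R\<close>, and this factor
    cancels.\<close>
  have law: "emeasure (rand_law pr) {t \<in> space (rand_law pr). msgs pr I (v, t) \<in> C}
      = emeasure J (V -` (C \<times> space (round2_space pr)) \<inter> space J)"
    if v: "v \<in> R" and C: "C \<in> sets (PiM I (\<lambda>_. count_space UNIV))" for v C
  proof -
    have vd: "v \<in> data d I" using v R by (auto simp: I_def)
    have fin: "finite R" by (simp add: R_def)
    have [measurable]: "C \<times> space (round2_space pr) \<in> sets S"
      using C unfolding S_def view_space_def by (auto intro!: pair_measureI simp: I_def)
    note [measurable] = sing_T[OF vd]
    let ?E = "(\<lambda>\<omega>. (V \<omega>, (X \<omega>, Z \<omega>))) -` ((C \<times> space (round2_space pr)) \<times> {(v, vsum I v)}) \<inter> space J"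
    let ?F = "(\<lambda>\<omega>. (X \<omega>, Z \<omega>)) -` {(v, vsum I v)} \<inter> space J"
    have [measurable]: "?F \<in> sets J" by measurable
    have E_eq: "?E = V -` (C \<times> space (round2_space pr)) \<inter> space J \<inter> ?F" by auto
    have "V -` (C \<times> space (round2_space pr)) \<inter> space J \<in> sets J" by measurable
    then have [measurable]: "?E \<in> sets J" unfolding E_eq by simp
    have r2: "round2 pr t {} \<in> space (round2_space pr)" if "t \<in> space (rand_law pr)" for t
      using measurable_space[OF measurable_round2[of "{}"] that] by simp
    have E: "emeasure J ?E
        = emeasure (rand_law pr) {t \<in> space (rand_law pr). msgs pr I (v, t) \<in> C} / of_nat (card R)"
    proof -
      have "{t \<in> space (rand_law pr). (v, t) \<in> ?E} = {t \<in> space (rand_law pr). msgs pr I (v, t) \<in> C}"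
        using r2 vd by (auto simp: space_J X_eq Z_def V_def server_view_def I_def)
      moreover have "emeasure J ?E
          = emeasure (rand_law pr) {t \<in> space (rand_law pr). (v, t) \<in> ?E} / of_nat (card R)"
        unfolding J_def
      proof (rule emeasure_joint_uniform_single[OF R v], unfold J_def[symmetric])
        show "?E \<in> sets J" by fact
        show "(u, t) \<notin> ?E" if "u \<noteq> v" for u t
          using that by (auto simp: space_J X_eq)
      qed
      ultimately show ?thesis by simp
    qed
    have F: "emeasure J ?F = 1 / of_nat (card R)"
    proof -
      have "{t \<in> space (rand_law pr). (v, t) \<in> ?F} = space (rand_law pr)"
        using vd by (auto simp: space_J X_eq Z_def)
      moreover have "emeasure J ?F
          = emeasure (rand_law pr) {t \<in> space (rand_law pr). (v, t) \<in> ?F} / of_nat (card R)"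
        unfolding J_def
      proof (rule emeasure_joint_uniform_single[OF R v], unfold J_def[symmetric])
        show "?F \<in> sets J" by fact
        show "(u, t) \<notin> ?F" if "u \<noteq> v" for u t
          using that by (auto simp: space_J X_eq)
      qed
      ultimately show ?thesis by (simp add: Q.emeasure_space_1)
    qed
    have "emeasure J ?E = emeasure (distr J (S \<Otimes>\<^sub>M T) (\<lambda>\<omega>. (V \<omega>, (X \<omega>, Z \<omega>))))
        ((C \<times> space (round2_space pr)) \<times> {(v, vsum I v)})"
      by (rule emeasure_distr[symmetric]) measurable
    also have "\<dots> = emeasure J (V -` (C \<times> space (round2_space pr)) \<inter> space J) * emeasure J ?F"
      unfolding indep by (simp add: XZ.emeasure_pair_measure_Times emeasure_distr)
    finally have "emeasure J ?E = emeasure J (V -` (C \<times> space (round2_space pr)) \<inter> space J) * emeasure J ?F" .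
    then have "emeasure (rand_law pr) {t \<in> space (rand_law pr). msgs pr I (v, t) \<in> C} / of_nat (card R)
        = emeasure J (V -` (C \<times> space (round2_space pr)) \<inter> space J) / of_nat (card R)"
      unfolding E F by (simp add: ennreal_times_divide)
    then have "emeasure (rand_law pr) {t \<in> space (rand_law pr). msgs pr I (v, t) \<in> C} / of_nat (card R) * of_nat (card R)
        = emeasure J (V -` (C \<times> space (round2_space pr)) \<inter> space J) / of_nat (card R) * of_nat (card R)"
      by simp
    moreover have "of_nat (card R) / of_nat (card R) = (1 :: ennreal)"
      using fin R by (intro ennreal_divide_self) (auto simp: of_nat_less_top)
    ultimately show ?thesis
      by (simp add: ennreal_divide_times)
  qed
  show ?thesis
  proof (rule measure_eqI)
    fix C assume C: "C \<in> sets (distr (rand_law pr) (PiM {1..n} (\<lambda>_. count_space UNIV)) (\<lambda>t. msgs pr {1..n} (x, t)))"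
    then have C': "C \<in> sets (PiM I (\<lambda>_. count_space UNIV))" by (simp add: I_def)
    have "emeasure (rand_law pr) {t \<in> space (rand_law pr). msgs pr I (x, t) \<in> C}
        = emeasure (rand_law pr) {t \<in> space (rand_law pr). msgs pr I (y, t) \<in> C}"
      using law[OF _ C', of x] law[OF _ C', of y] by (simp add: R_def)
    then show "emeasure (distr (rand_law pr) (PiM {1..n} (\<lambda>_. count_space UNIV)) (\<lambda>t. msgs pr {1..n} (x, t))) C
        = emeasure (distr (rand_law pr) (PiM {1..n} (\<lambda>_. count_space UNIV)) (\<lambda>t. msgs pr {1..n} (y, t))) C"
      using C' measurable_msgs[OF x(1) subset_refl] measurable_msgs[OF x(2) subset_refl]
      by (simp add: emeasure_distr vimage_def Int_def I_def conj_commute)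
  qed simp
qed

text \<open>Invariance under equal sums is inherited from the law of all messages by
  marginalization, and invariance under changes of \<open>x i\<close> holds because the other
  encoders do not read that entry.\<close>

lemma distr_other_msgs_const:
  assumes sec: "secure_given_sum n d pr" and i: "i \<in> {1..n}"
    and x: "x \<in> data d {1..n}" and y: "y \<in> data d {1..n}"
  shows "distr (rand_law pr) (PiM ({1..n} - {i}) (\<lambda>_. count_space UNIV)) (\<lambda>t. msgs pr ({1..n} - {i}) (x, t))
    = distr (rand_law pr) (PiM ({1..n} - {i}) (\<lambda>_. count_space UNIV)) (\<lambda>t. msgs pr ({1..n} - {i}) (y, t))"
    (is "?law x = ?law y")
proof (rule data_function_const[OF _ i _ _ x y, where F = ?law])
  have law: "?law x = distr (distr (rand_law pr) (PiM {1..n} (\<lambda>_. count_space UNIV)) (\<lambda>t. msgs pr {1..n} (x, t)))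
      (PiM ({1..n} - {i}) (\<lambda>_. count_space UNIV)) (\<lambda>w. restrict w ({1..n} - {i}))"
    if "x \<in> data d {1..n}" for x
  proof -
    have "msgs pr ({1..n} - {i}) (x, t) = restrict (msgs pr {1..n} (x, t)) ({1..n} - {i})" for t
      by (auto simp: msgs_def)
    then show ?thesis
      using that by (subst distr_distr) (auto intro!: measurable_msgs measurable_restrict_subset simp: comp_def)
  qed
  show "?law x = ?law y"
    if "x \<in> data d {1..n}" "y \<in> data d {1..n}" "vsum {1..n} x = vsum {1..n} y" for x y
    using distr_msgs_eq_of_vsum_eq[OF sec that] that by (simp add: law)
  have "msgs pr ({1..n} - {i}) (x(i := v), t) = msgs pr ({1..n} - {i}) (x, t)" for x v t
    by (auto simp: msgs_def msg_def)
  then show "?law (x(i := v)) = ?law x" for x v by (simp del: fun_upd_apply)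
qed simp

section \<open>Consequences of correctness and the entropy of a message\<close>

text \<open>(C1) for the point mass at \<open>x\<close>, with the empty dropout set. Almost
  everywhere under this prior means at \<open>x\<close>, so only the randomness remains.\<close>

lemma correct_without_dropouts:
  assumes cor: "correct n d D pr" and x: "x \<in> data d {1..n}"
  shows "AE t in rand_law pr. dec pr {} (msgs pr {1..n} (x, t)) (round2 pr t {}) = vsum {1..n} x"
proof -
  interpret Q: prob_space "rand_law pr" by (rule prob_space_rand_law)
  have P: "data_prior n d (uniform_data n d {x})" using x by (intro data_prior_uniform) auto
  interpret P: prob_space "uniform_data n d {x}" using P by (simp add: data_prior_def)
  interpret PQ: pair_prob_space "uniform_data n d {x}" "rand_law pr" by standard
  have "AE \<omega> in uniform_data n d {x} \<Otimes>\<^sub>M rand_law pr.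
      dec pr {} (msgs pr {1..n} \<omega>) (round2 pr (snd \<omega>) {}) = vsum {1..n} (fst \<omega>)"
    using cor[unfolded correct_def joint_def, rule_format, OF P empty_subsetI] by simp
  then have "AE u in uniform_data n d {x}. AE t in rand_law pr.
      dec pr {} (msgs pr {1..n} (u, t)) (round2 pr t {}) = vsum {1..n} u"
    by (auto dest: PQ.AE_pair)
  then have "AE u in count_space (data d {1..n}). u \<in> {x} \<longrightarrow>
      (AE t in rand_law pr. dec pr {} (msgs pr {1..n} (u, t)) (round2 pr t {}) = vsum {1..n} u)"
    using x by (subst (asm) AE_uniform_measure) simp_all
  with x show ?thesis
    unfolding AE_count_space by blast
qed

text \<open>\<open>B x\<close> below collects the messages of the other users that, together with \<open>y\<close>, decode to the sum
  of \<open>x\<close>. These sets are disjoint for different sums, and all of them are measured by one law.\<close>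

lemma sum_prob_msg_le_1:
  assumes sec: "secure_given_sum n d pr" and cor: "correct n d D pr" and i: "i \<in> {1..n}"
    and R: "R \<subseteq> data d {1..n}" "inj_on (vsum {1..n}) R"
  shows "(\<Sum>x\<in>R. emeasure (rand_law pr) {t \<in> space (rand_law pr). enc pr i (x i) (t i) = y}) \<le> 1"
proof (cases "R = {}")
  case False
  then obtain x0 where x0: "x0 \<in> R" by auto
  have fin: "finite R" using R finite_data[of "{1..n}" d] by (auto intro: finite_subset)
  interpret Q: prob_space "rand_law pr" by (rule prob_space_rand_law)
  \<comment> \<open>As the second round is constant without dropouts, decoding depends on the
    messages alone, and \<open>B\<close> below can be a set of messages.\<close>
  obtain c where c: "\<And>t. t \<in> space (rand_law pr) \<Longrightarrow> round2 pr t {} = c"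
    using prot by (auto simp: aggregation_protocol_def)
  define I where "I = {1..n}"
  define K where "K = I - {i}"
  define L where "L x = distr (rand_law pr) (PiM K (\<lambda>_. count_space UNIV)) (\<lambda>t. msgs pr K (x, t))" for x
  define B where "B x = {z \<in> PiE K (\<lambda>_. UNIV). dec pr {} (z(i := y)) c = vsum I x}" for x
  \<comment> \<open>A finite product of countable discrete spaces is discrete, so every set of
    messages is an event.\<close>
  have PiM: "PiM K (\<lambda>_. count_space (UNIV :: 'y set)) = count_space (PiE K (\<lambda>_. UNIV))"
    unfolding K_def I_def by (rule count_space_PiM_finite) auto
  have B[measurable]: "B x \<in> sets (PiM K (\<lambda>_. count_space UNIV))" for x
    by (auto simp: PiM B_def)
  have meas: "(\<lambda>t. msgs pr K (x, t)) \<in> rand_law pr \<rightarrow>\<^sub>M PiM K (\<lambda>_. count_space UNIV)" if "x \<in> R" for x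
    using that R by (intro measurable_msgs) (auto simp: K_def I_def)
  interpret L: prob_space "L x0"
    unfolding L_def by (rule Q.prob_space_distr[OF meas[OF x0]])
  have "emeasure (rand_law pr) {t \<in> space (rand_law pr). enc pr i (x i) (t i) = y} \<le> emeasure (L x0) (B x)"
    if x: "x \<in> R" for x
  proof -
    have xd: "x \<in> data d {1..n}" using x R by auto
    have "AE t in rand_law pr. enc pr i (x i) (t i) = y \<longrightarrow> msgs pr K (x, t) \<in> B x"
      using correct_without_dropouts[OF cor xd] AE_space
    proof eventually_elim
      case (elim t)
      show ?case
      proof
        assume "enc pr i (x i) (t i) = y"
        then have "(msgs pr K (x, t))(i := y) = msgs pr I (x, t)"
          using i by (auto simp: msgs_def msg_def K_def I_def)
        moreover have "msgs pr K (x, t) \<in> PiE K (\<lambda>_. UNIV)" by (simp add: msgs_def)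
        ultimately show "msgs pr K (x, t) \<in> B x"
          using elim c by (simp add: B_def I_def del: fun_upd_apply)
      qed
    qed
    then have "emeasure (rand_law pr) {t \<in> space (rand_law pr). enc pr i (x i) (t i) = y}
        \<le> emeasure (rand_law pr) ((\<lambda>t. msgs pr K (x, t)) -` B x \<inter> space (rand_law pr))"
      using meas[OF x] by (intro emeasure_mono_AE) auto
    also have "\<dots> = emeasure (L x) (B x)"
      unfolding L_def by (rule emeasure_distr[symmetric, OF meas[OF x] B])
    also have "L x = L x0"
      unfolding L_def K_def I_def using x x0 R by (intro distr_other_msgs_const[OF sec i]) auto
    finally show ?thesis .
  qed
  then have "(\<Sum>x\<in>R. emeasure (rand_law pr) {t \<in> space (rand_law pr). enc pr i (x i) (t i) = y})
      \<le> (\<Sum>x\<in>R. emeasure (L x0) (B x))"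
    by (rule sum_mono)
  also have "\<dots> = emeasure (L x0) (\<Union>x\<in>R. B x)"
  proof (rule sum_emeasure)
    show "B ` R \<subseteq> sets (L x0)" using B by (auto simp: L_def)
    \<comment> \<open>A tuple of messages decodes to one value, while distinct elements of
      \<open>R\<close> have distinct sums.\<close>
    show "disjoint_family_on B R"
      using R(2) by (auto simp: disjoint_family_on_def B_def I_def dest: inj_onD)
  qed fact
  also have "\<dots> \<le> 1" by (rule L.emeasure_le_1)
  finally show ?thesis .
qed simp

text \<open>The probability of \<open>Y_i = y\<close> is the average over \<open>R\<close> of the
  probabilities in \<open>sum_prob_msg_le_1\<close>, hence at most
  \<open>1 / card R\<close>.\<close>

lemma shannon_entropy_msg_ge:
  assumes sec: "secure_given_sum n d pr" and cor: "correct n d D pr" and i: "i \<in> {1..n}"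
    and R: "R \<noteq> {}" "R \<subseteq> data d {1..n}" "inj_on (vsum {1..n}) R"
  shows "ennreal (log 2 (card R)) \<le> shannon_entropy (joint (uniform_data n d R) pr) (msg pr i)"
proof -
  let ?J = "joint (uniform_data n d R) pr"
  have P: "data_prior n d (uniform_data n d R)" by (rule data_prior_uniform) fact+
  have fin: "finite R" using R finite_data[of "{1..n}" d] by (auto intro: finite_subset)
  interpret J: prob_space ?J by (rule prob_space_joint[OF P])
  have msg[measurable]: "msg pr i \<in> ?J \<rightarrow>\<^sub>M count_space UNIV"
    using i by (intro measurable_joint[OF P]) (simp add: msg_def measurable_enc)
  have N: "card R > 0" using fin R by (simp add: card_gt_0_iff)
  have le: "measure ?J (msg pr i -` {y} \<inter> space ?J) \<le> 1 / real (card R)" for y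
  proof -
    have "emeasure ?J (msg pr i -` {y} \<inter> space ?J)
        = (\<Sum>x\<in>R. emeasure (rand_law pr) {t \<in> space (rand_law pr). (x, t) \<in> msg pr i -` {y} \<inter> space ?J}) / of_nat (card R)"
      by (rule emeasure_joint_uniform[OF R(1,2) measurable_sets[OF msg]]) simp
    also have "\<dots> = (\<Sum>x\<in>R. emeasure (rand_law pr) {t \<in> space (rand_law pr). enc pr i (x i) (t i) = y}) / of_nat (card R)"
      using R(2) by (intro arg_cong2[of _ _ _ _ divide] sum.cong arg_cong[of _ _ "emeasure _"])
        (auto simp: space_joint[OF P] msg_def)
    also have "\<dots> \<le> 1 / of_nat (card R)"
      by (intro divide_right_mono_ennreal sum_prob_msg_le_1[OF sec cor i R(2,3)])
    also have "\<dots> = ennreal (1 / real (card R))"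
      using N by (simp add: divide_ennreal[symmetric] ennreal_of_nat_eq_real_of_nat)
    finally show ?thesis by (simp add: J.emeasure_eq_measure)
  qed
  show ?thesis
    by (rule shannon_entropy_ge_log[OF J.prob_space_axioms msg _ le]) (use N in simp)
qed

end

section \<open>The worst-case prior and the asymptotic bound\<close>

theorem corollary4p1:
  fixes \<epsilon> :: real
  assumes "\<epsilon> > 0"
  shows "\<exists>\<pi> :: nat \<Rightarrow> nat \<Rightarrow> (nat \<Rightarrow> vec) measure.
    (\<forall>(n, d) \<in> large_dim \<epsilon>. data_prior n d (\<pi> n d)) \<and>
    (\<forall>(n, d) \<in> large_dim \<epsilon>. \<forall>D :: nat. \<forall>pr :: ('t, 'y::countable, 'h) protocol.
      real D \<le> real n / 2 \<longrightarrow>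
      aggregation_protocol n d pr \<longrightarrow>
      correct n d D pr \<longrightarrow> secure_given_sum n d pr \<longrightarrow> secure_many_dropouts n d D pr \<longrightarrow>
      (\<forall>i\<in>{1..n}. shannon_entropy (joint (\<pi> n d) pr) (msg pr i)
                    \<ge> shannon_entropy (\<pi> n d) (vsum {1..n}))) \<and>
    (\<lambda>(n, d). enn2real (shannon_entropy (\<pi> n d) (vsum {1..n})))
      \<in> \<Omega>[principal (large_dim \<epsilon>)](\<lambda>(n, d). real n * log 2 (real d))"
proof -
  \<comment> \<open>\<open>inv_into\<close> selects one data tuple for each attainable sum, which
    makes \<open>vsum\<close> injective on \<open>R n d\<close> without losing any sum.\<close>
  define R where "R n d = inv_into (data d {1..n}) (vsum {1..n}) ` (vsum {1..n} ` data d {1..n})" for n d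
  define \<pi> where "\<pi> n d = uniform_data n d (R n d)" for n d
  have d1: "1 \<le> d" if "(n, d) \<in> large_dim \<epsilon>" for n d
    using large_dim_ge_1 assms that by auto
  have R_sub: "R n d \<subseteq> data d {1..n}" for n d
    by (auto simp: R_def inv_into_into)
  have R_inj: "inj_on (vsum {1..n}) (R n d)" for n d
    by (auto simp: R_def inj_on_def f_inv_into_f)
  have R_card: "card (R n d) = card (vsum {1..n} ` data d {1..n})" for n d
    unfolding R_def by (intro card_image inj_on_inv_into) simp
  have R_fin: "finite (R n d)" for n d
    using R_sub finite_data[of "{1..n}" d] by (auto intro: finite_subset)
  have R_ne: "R n d \<noteq> {}" if "(n, d) \<in> large_dim \<epsilon>" for n d
  proof -
    have "data d {1..n} \<noteq> {}"
      using d1[OF that] by (auto simp: data_def PiE_eq_empty_iff one_hots_def)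
    then show ?thesis by (simp add: R_def)
  qed
  have H: "shannon_entropy (\<pi> n d) (vsum {1..n}) = ennreal (log 2 (card (R n d)))"
    if "(n, d) \<in> large_dim \<epsilon>" for n d
    unfolding \<pi>_def by (intro shannon_entropy_uniform R_fin R_ne R_sub R_inj that)
  \<comment> \<open>Both logarithms are nonnegative, since \<open>d\<close> and
    \<open>card (R n d)\<close> are at least \<open>1\<close>; hence the norms and
    \<open>enn2real\<close> change nothing.\<close>
  have bound: "\<epsilon> / (1 + \<epsilon>) * norm (real n * log 2 (real d)) \<le> norm (enn2real (shannon_entropy (\<pi> n d) (vsum {1..n})))"
    if nd: "(n, d) \<in> large_dim \<epsilon>" for n d
  proof -
    have "card (R n d) > 0" using R_ne[OF nd] R_fin by (simp add: card_gt_0_iff)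
    then show ?thesis
      using log_card_vsum_image_ge[OF assms nd] d1[OF nd] H[OF nd] by (simp add: R_card abs_mult)
  qed
  show ?thesis
  proof (intro exI[of _ \<pi>] conjI)
    show "\<forall>(n, d) \<in> large_dim \<epsilon>. data_prior n d (\<pi> n d)"
      unfolding \<pi>_def by safe (rule data_prior_uniform[OF R_ne R_sub])
    show "\<forall>(n, d) \<in> large_dim \<epsilon>. \<forall>D :: nat. \<forall>pr :: ('t, 'y::countable, 'h) protocol.
      real D \<le> real n / 2 \<longrightarrow>
      aggregation_protocol n d pr \<longrightarrow>
      correct n d D pr \<longrightarrow> secure_given_sum n d pr \<longrightarrow> secure_many_dropouts n d D pr \<longrightarrow>
      (\<forall>i\<in>{1..n}. shannon_entropy (joint (\<pi> n d) pr) (msg pr i)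
                    \<ge> shannon_entropy (\<pi> n d) (vsum {1..n}))"
    proof safe
      fix n d D i and pr :: "('t, 'y, 'h) protocol"
      assume nd: "(n, d) \<in> large_dim \<epsilon>" and "aggregation_protocol n d pr" "correct n d D pr"
        "secure_given_sum n d pr" "i \<in> {1..n}"
      then show "shannon_entropy (\<pi> n d) (vsum {1..n}) \<le> shannon_entropy (joint (\<pi> n d) pr) (msg pr i)"
        unfolding H[OF nd] unfolding \<pi>_def
        by (intro shannon_entropy_msg_ge R_ne R_sub R_inj)
    qed
    show "(\<lambda>(n, d). enn2real (shannon_entropy (\<pi> n d) (vsum {1..n})))
      \<in> \<Omega>[principal (large_dim \<epsilon>)](\<lambda>(n, d). real n * log 2 (real d))"
      \<comment> \<open>For a principal filter, eventually means everywhere in the regime, so one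
        constant serves all pairs \<open>(n, d)\<close>.\<close>
      by (rule landau_omega.bigI[of "\<epsilon> / (1 + \<epsilon>)"])
        (use assms bound in \<open>auto simp: eventually_principal simp del: real_norm_def\<close>)
  qed
qed

end
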